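(* A connected connectoid $(S,\mathcal{C})$ has a normal spanning tree if and only if $(S,\mathcal{C})$ has countable separation number.
   Context: Connectoids: let $S$ be a set and let $\mathcal{F}$ be a set of finite subsets of $S$ such that (i) $F\cup F'\in\mathcal{F}$ whenever $F,F'\in\mathcal{F}$ and $F\cap F'\neq\emptyset$, and (ii) $\emptyset\in\mathcal{F}$ and $\{s\}\in\mathcal{F}$ for every $s\in S$. A subset $C\subseteq S$ is connected if for every $x,y\in C$ there is $F\in\mathcal{F}$ with $F\subseteq C$ and $x,y\in F$. The pair $(S,\mathcal{C})$, where $\mathcal{C}$ is the set of connected subsets of $S$, is the connectoid induced by $\mathcal{F}$; a connectoid is any pair arising in this way. It is connected if $S\in\mathcal{C}$. For $S'\subseteq S$, a component of $S'$ is a maximal connected subset of $S'$, and $\mathcal{K}(S')$ is the set of components of $S'$. Necklaces: with $\mathbb{N}=\{1,2,3,\dots\}$, a connected set $N$ is a necklace if there is a family $(H_n)_{n\in\mathbb{N}}$ of finite connected sets with $N=\bigcup_{n}H_n$ such that, for all $i,j\in\mathbb{N}$, $H_i\cap H_j\neq\emptyset$ if and only if $|i-j|\leq 1$. Normal trees: $\leq_T$ denotes the tree-order of a rooted tree $T$. A weak normal tree of $(S,\mathcal{C})$ is a rooted undirected tree $T$ with $V(T)\subseteq S$ such that (a) for every $C\in\mathcal{C}$ and every two $\leq_T$-incomparable $u,v\in C\cap V(T)$ there is $w\in C$ with $w\leq_T u,v$, and (b) for every $u\leq_T v$ in $V(T)$ there is $C\in\mathcal{C}$ with $u,v\in C$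 that contains no $w<_T u$. A weak normal tree $T$ is a normal tree if moreover for every ray $R$ in $T$ starting at the root there is a necklace containing all but finitely many elements of $V(R)$. It is spanning if $V(T)=S$. Countable separation number: a connected connectoid $(S,\mathcal{C})$ has countable separation number if there is a well-order $\leq$ of $S$ such that for every $s\in S$ there is a finite set $X\subseteq\{t\in S: t<s\}$ such that the component in $\mathcal{K}(S\setminus X)$ containing $s$ is disjoint from $\{t\in S:t<s\}$. *)

theory Defs
  imports Main
begin

section \<open>Connectoids\<close>

definition generating_family :: "'a set \<Rightarrow> 'a set set \<Rightarrow> bool" where
  "generating_family S \<F> \<longleftrightarrow>
     (\<forall>F\<in>\<F>. finite F \<and> F \<subseteq> S) \<and>
     (\<forall>F\<in>\<F>. \<forall>F'\<in>\<F>. F \<inter> F' \<noteq> {} \<longrightarrow> F \<union> F' \<in> \<F>) \<and>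
     {} \<in> \<F> \<and> (\<forall>s\<in>S. {s} \<in> \<F>)"

definition induced_connected_sets :: "'a set \<Rightarrow> 'a set set \<Rightarrow> 'a set set" where
  "induced_connected_sets S \<F> =
     {C. C \<subseteq> S \<and> (\<forall>x\<in>C. \<forall>y\<in>C. \<exists>F\<in>\<F>. F \<subseteq> C \<and> x \<in> F \<and> y \<in> F)}"

definition connectoid :: "'a set \<Rightarrow> 'a set set \<Rightarrow> bool" where
  "connectoid S \<C> \<longleftrightarrow> (\<exists>\<F>. generating_family S \<F> \<and> \<C> = induced_connected_sets S \<F>)"

definition connected_connectoid :: "'a set \<Rightarrow> 'a set set \<Rightarrow> bool" where
  "connected_connectoid S \<C> \<longleftrightarrow> connectoid S \<C> \<and> S \<in> \<C>"

definition connectoid_components :: "'a set set \<Rightarrow> 'a set \<Rightarrow> 'a set set" where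
  "connectoid_components \<C> S' =
     {K. K \<in> \<C> \<and> K \<subseteq> S' \<and> (\<forall>K'\<in>\<C>. K' \<subseteq> S' \<and> K \<subseteq> K' \<longrightarrow> K' = K)}"

definition necklace :: "'a set set \<Rightarrow> 'a set \<Rightarrow> bool" where
  "necklace \<C> N \<longleftrightarrow> N \<in> \<C> \<and>
     (\<exists>H :: nat \<Rightarrow> 'a set.
        (\<forall>n\<ge>1. finite (H n) \<and> H n \<in> \<C>) \<and> N = (\<Union>n\<in>{1..}. H n) \<and>
        (\<forall>i\<ge>1. \<forall>j\<ge>1. H i \<inter> H j \<noteq> {} \<longleftrightarrow> \<bar>int i - int j\<bar> \<le> 1))"


section \<open>Rooted undirected trees\<close>

text \<open>A simple undirected graph is given by its vertex set \<open>V\<close> and its set \<open>E\<close> of two-element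
  subsets of \<open>V\<close>; both may be infinite. The trees of \<open>Graph_Theory\<close> are not used since a pair of
  opposite arcs is a cycle there.\<close>

definition simple_graph :: "'a set \<Rightarrow> 'a set set \<Rightarrow> bool" where
  "simple_graph V E \<longleftrightarrow> (\<forall>e\<in>E. e \<subseteq> V \<and> card e = 2)"

definition graph_path :: "'a set \<Rightarrow> 'a set set \<Rightarrow> 'a list \<Rightarrow> bool" where
  "graph_path V E p \<longleftrightarrow> p \<noteq> [] \<and> set p \<subseteq> V \<and> distinct p \<and>
     (\<forall>i. Suc i < length p \<longrightarrow> {p ! i, p ! Suc i} \<in> E)"

definition graph_cycle :: "'a set \<Rightarrow> 'a set set \<Rightarrow> 'a list \<Rightarrow> bool" where
  "graph_cycle V E p \<longleftrightarrow> graph_path V E p \<and> length p \<ge> 3 \<and> {last p, hd p} \<in> E"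

definition graph_connected :: "'a set \<Rightarrow> 'a set set \<Rightarrow> bool" where
  "graph_connected V E \<longleftrightarrow> V \<noteq> {} \<and>
     (\<forall>u\<in>V. \<forall>v\<in>V. \<exists>p. graph_path V E p \<and> hd p = u \<and> last p = v)"

definition undirected_tree :: "'a set \<Rightarrow> 'a set set \<Rightarrow> bool" where
  "undirected_tree V E \<longleftrightarrow> simple_graph V E \<and> graph_connected V E \<and> (\<nexists>p. graph_cycle V E p)"

definition rooted_tree :: "'a set \<Rightarrow> 'a set set \<Rightarrow> 'a \<Rightarrow> bool" where
  "rooted_tree V E r \<longleftrightarrow> undirected_tree V E \<and> r \<in> V"

text \<open>The tree-order: \<open>u\<close> lies on the (in a tree, unique) path from the root \<open>r\<close> to \<open>v\<close>.\<close>

definition tree_le :: "'a set \<Rightarrow> 'a set set \<Rightarrow> 'a \<Rightarrow> 'a \<Rightarrow> 'a \<Rightarrow> bool" where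
  "tree_le V E r u v \<longleftrightarrow> (\<exists>p. graph_path V E p \<and> hd p = r \<and> last p = v \<and> u \<in> set p)"

definition tree_less :: "'a set \<Rightarrow> 'a set set \<Rightarrow> 'a \<Rightarrow> 'a \<Rightarrow> 'a \<Rightarrow> bool" where
  "tree_less V E r u v \<longleftrightarrow> tree_le V E r u v \<and> u \<noteq> v"

definition graph_ray :: "'a set \<Rightarrow> 'a set set \<Rightarrow> (nat \<Rightarrow> 'a) \<Rightarrow> bool" where
  "graph_ray V E R \<longleftrightarrow> range R \<subseteq> V \<and> inj R \<and> (\<forall>n. {R n, R (Suc n)} \<in> E)"


section \<open>Normal trees\<close>

definition weak_normal_tree ::
    "'a set \<Rightarrow> 'a set set \<Rightarrow> 'a set \<Rightarrow> 'a set set \<Rightarrow> 'a \<Rightarrow> bool" where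
  "weak_normal_tree S \<C> V E r \<longleftrightarrow> rooted_tree V E r \<and> V \<subseteq> S \<and>
     (\<forall>C\<in>\<C>. \<forall>u\<in>C \<inter> V. \<forall>v\<in>C \<inter> V.
        \<not> tree_le V E r u v \<and> \<not> tree_le V E r v u \<longrightarrow>
          (\<exists>w\<in>C. tree_le V E r w u \<and> tree_le V E r w v)) \<and>
     (\<forall>u\<in>V. \<forall>v\<in>V. tree_le V E r u v \<longrightarrow>
        (\<exists>C\<in>\<C>. u \<in> C \<and> v \<in> C \<and> \<not> (\<exists>w\<in>C. tree_less V E r w u)))"

definition normal_tree ::
    "'a set \<Rightarrow> 'a set set \<Rightarrow> 'a set \<Rightarrow> 'a set set \<Rightarrow> 'a \<Rightarrow> bool" where
  "normal_tree S \<C> V E r \<longleftrightarrow> weak_normal_tree S \<C> V E r \<and>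
     (\<forall>R. graph_ray V E R \<and> R 0 = r \<longrightarrow> (\<exists>N. necklace \<C> N \<and> finite (range R - N)))"

definition has_normal_spanning_tree :: "'a set \<Rightarrow> 'a set set \<Rightarrow> bool" where
  "has_normal_spanning_tree S \<C> \<longleftrightarrow> (\<exists>V E r. normal_tree S \<C> V E r \<and> V = S)"


section \<open>Countable separation number\<close>

text \<open>\<open>underS less_eq s\<close> is the set of all elements of \<open>S\<close> strictly below \<open>s\<close>.\<close>

definition countable_separation_number :: "'a set \<Rightarrow> 'a set set \<Rightarrow> bool" where
  "countable_separation_number S \<C> \<longleftrightarrow>
     (\<exists>less_eq. well_order_on S less_eq \<and>
        (\<forall>s\<in>S. \<exists>X. finite X \<and> X \<subseteq> underS less_eq s \<and>
           (\<exists>K\<in>connectoid_components \<C> (S - X). s \<in> K \<and> K \<inter> underS less_eq s = {})))"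

end

theory Submission
  imports Defs
begin

text \<open>Given a normal spanning tree, order \<open>S\<close> by the height in the tree, breaking ties by any
  well-order; the finitely many elements strictly below \<open>s\<close> in the tree separate \<open>s\<close> from everything
  earlier. Conversely, let \<open>K s\<close> be the component of \<open>s\<close> given by a witnessing well-order. It is the
  largest connected set with least element \<open>s\<close>, so these sets form a laminar family, and
  \<open>s \<le> t \<longleftrightarrow> t \<in> K s\<close> is an order in which the elements below any \<open>t\<close> form a finite chain, that is,
  the order of a rooted tree. Along a ray \<open>Q\<close> of this tree the sets \<open>K (Q n)\<close> decrease to the empty set,
  so finite connected sets joining \<open>Q n\<close> to \<open>Q (n + 1)\<close> inside \<open>K (Q n)\<close> can be grouped into a
  necklace.\<close>

section \<open>Connected sets\<close>

lemma connected_subset: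
  assumes "connectoid S \<C>" "A \<in> \<C>"
  shows "A \<subseteq> S"
  using assms by (auto simp: connectoid_def induced_connected_sets_def)

text \<open>Each \<open>A\<close> supplies a member of the generating family that joins
  \<open>x\<close> and \<open>y\<close> inside \<open>A\<close>, so connectedness can be tested with
  arbitrary connected sets in place of that family.\<close>

lemma connectedI:
  assumes "connectoid S \<C>"
    and "\<And>x y. x \<in> D \<Longrightarrow> y \<in> D \<Longrightarrow> \<exists>A\<in>\<C>. A \<subseteq> D \<and> x \<in> A \<and> y \<in> A"
  shows "D \<in> \<C>"
proof -
  obtain \<F> where \<C>: "\<C> = induced_connected_sets S \<F>"
    using assms(1) by (auto simp: connectoid_def)
  have "D \<subseteq> S"
    using assms(2) connected_subset[OF assms(1)] by blast
  moreover have "\<exists>F\<in>\<F>. F \<subseteq> D \<and> x \<in> F \<and> y \<in> F" if xy: "x \<in> D" "y \<in> D" for x y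
  proof -
    obtain A where A: "A \<in> \<C>" "A \<subseteq> D" "x \<in> A" "y \<in> A"
      using assms(2)[OF xy] by blast
    then obtain F where "F \<in> \<F>" "F \<subseteq> A" "x \<in> F" "y \<in> F"
      unfolding \<C> induced_connected_sets_def by blast
    with A show ?thesis by blast
  qed
  ultimately show ?thesis
    unfolding \<C> induced_connected_sets_def by blast
qed

lemma singleton_connected:
  assumes "connectoid S \<C>" "s \<in> S"
  shows "{s} \<in> \<C>"
  using assms by (auto simp: connectoid_def generating_family_def induced_connected_sets_def)

lemma finite_connected_joining:
  assumes "connectoid S \<C>" "A \<in> \<C>" "x \<in> A" "y \<in> A"
  obtains F where "F \<in> \<C>" "finite F" "F \<subseteq> A" "x \<in> F" "y \<in> F"
proof -
  obtain \<F> where \<F>: "generating_family S \<F>" and \<C>: "\<C> = induced_connected_sets S \<F>"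
    using assms(1) by (auto simp: connectoid_def)
  obtain F where F: "F \<in> \<F>" "F \<subseteq> A" "x \<in> F" "y \<in> F"
    using assms(2-4) unfolding \<C> induced_connected_sets_def by blast
  moreover have "finite F" "F \<subseteq> S"
    using \<F> F(1) by (auto simp: generating_family_def)
  \<comment> \<open>A member of the generating family is its own witness for any two of its
    points.\<close>
  moreover have "F \<in> \<C>"
    using \<open>F \<subseteq> S\<close> F(1) unfolding \<C> induced_connected_sets_def by blast
  ultimately show ?thesis using that by blast
qed

text \<open>Any two points are joined to a common point \<open>z\<close> of \<open>A\<close> and
  \<open>B\<close>; the two finite sets used meet in \<open>z\<close>, so their union is again in
  the generating family.\<close>

lemma connected_Un:
  assumes "connectoid S \<C>" "A \<in> \<C>" "B \<in> \<C>" "A \<inter> B \<noteq> {}"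
  shows "A \<union> B \<in> \<C>"
proof -
  obtain \<F> where \<F>: "generating_family S \<F>" and \<C>: "\<C> = induced_connected_sets S \<F>"
    using assms(1) by (auto simp: connectoid_def)
  obtain z where z: "z \<in> A" "z \<in> B" using assms(4) by auto
  have to_z: "\<exists>F\<in>\<F>. F \<subseteq> A \<union> B \<and> x \<in> F \<and> z \<in> F" if "x \<in> A \<union> B" for x
  proof -
    obtain D where D: "D = A \<or> D = B" "x \<in> D" using \<open>x \<in> A \<union> B\<close> by (metis UnE)
    have D': "D \<in> \<C>" "z \<in> D" "D \<subseteq> A \<union> B" using D z assms(2,3) by auto
    obtain F where "F \<in> \<F>" "F \<subseteq> D" "x \<in> F" "z \<in> F"
      using D'(1,2) D(2) unfolding \<C> induced_connected_sets_def by blast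
    then show ?thesis using D'(3) by blast
  qed
  have "\<exists>F\<in>\<F>. F \<subseteq> A \<union> B \<and> x \<in> F \<and> y \<in> F" if xy: "x \<in> A \<union> B" "y \<in> A \<union> B" for x y
  proof -
    obtain F where F: "F \<in> \<F>" "F \<subseteq> A \<union> B" "x \<in> F" "z \<in> F"
      using to_z[OF xy(1)] by blast
    obtain F' where F': "F' \<in> \<F>" "F' \<subseteq> A \<union> B" "y \<in> F'" "z \<in> F'"
      using to_z[OF xy(2)] by blast
    have "F \<inter> F' \<noteq> {}" using F F' by blast
    then have "F \<union> F' \<in> \<F>"
      using \<F> F(1) F'(1) by (simp add: generating_family_def)
    then show ?thesis using F F' by (intro bexI[of _ "F \<union> F'"]) auto
  qed
  moreover have "A \<union> B \<subseteq> S"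
    using connected_subset[OF assms(1)] assms(2,3) by simp
  ultimately show ?thesis
    by (simp add: \<C> induced_connected_sets_def)
qed

section \<open>Components\<close>

lemma component_exists:
  assumes "connectoid S \<C>" "s \<in> S'" "S' \<subseteq> S"
  obtains K where "K \<in> connectoid_components \<C> S'" "s \<in> K"
proof -
  \<comment> \<open>All sets in this union contain \<open>s\<close>, so the union is connected by
    \<open>connected_Un\<close>, and it contains every competitor for maximality.\<close>
  define K where "K = \<Union>{A \<in> \<C>. A \<subseteq> S' \<and> s \<in> A}"
  have sK: "s \<in> K"
    using singleton_connected[OF assms(1), of s] assms(2,3)
    unfolding K_def by (intro UnionI[of "{s}"]) auto
  have "K \<in> \<C>"
  proof (rule connectedI[OF assms(1)])
    fix x y assume "x \<in> K" "y \<in> K"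
    then obtain A B where AB: "A \<in> \<C>" "A \<subseteq> S'" "s \<in> A" "x \<in> A"
      "B \<in> \<C>" "B \<subseteq> S'" "s \<in> B" "y \<in> B"
      unfolding K_def by blast
    then have "A \<union> B \<in> \<C>"
      by (intro connected_Un[OF assms(1)]) auto
    moreover from this have "A \<union> B \<subseteq> K"
      using AB unfolding K_def by (intro Union_upper) simp
    ultimately show "\<exists>A\<in>\<C>. A \<subseteq> K \<and> x \<in> A \<and> y \<in> A"
      using AB by blast
  qed
  moreover have "K \<subseteq> S'" unfolding K_def by blast
  moreover have "K' = K" if "K' \<in> \<C>" "K' \<subseteq> S'" "K \<subseteq> K'" for K'
  proof
    show "K' \<subseteq> K" using that sK unfolding K_def by (intro Union_upper) auto
  qed fact
  ultimately have "K \<in> connectoid_components \<C> S'"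
    unfolding connectoid_components_def by blast
  then show ?thesis using sK that by blast
qed

lemma component_greatest:
  assumes "connectoid S \<C>" "K \<in> connectoid_components \<C> S'"
    and "A \<in> \<C>" "A \<subseteq> S'" "A \<inter> K \<noteq> {}"
  shows "A \<subseteq> K"
proof -
  have K: "K \<in> \<C>" "K \<subseteq> S'" and max: "\<And>K'. K' \<in> \<C> \<Longrightarrow> K' \<subseteq> S' \<Longrightarrow> K \<subseteq> K' \<Longrightarrow> K' = K"
    using assms(2) unfolding connectoid_components_def by simp_all
  have "A \<union> K \<in> \<C>" by (rule connected_Un[OF assms(1,3) K(1) assms(5)])
  then have "A \<union> K = K" using max[of "A \<union> K"] K(2) assms(4) by simp
  then show ?thesis by blast
qed

section \<open>Chains of connected sets and necklaces\<close>

lemma connected_chain_Union: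
  assumes "connectoid S \<C>" "\<And>n::nat. F n \<in> \<C>" "\<And>n. F n \<inter> F (Suc n) \<noteq> {}" "m < n"
  shows "\<Union> (F ` {m..<n}) \<in> \<C>"
  using assms(4)
proof (induction n)
  case (Suc n)
  show ?case
  proof (cases "m = n")
    case True
    then show ?thesis using assms(2) by simp
  next
    case False
    with Suc.prems have mn: "m < n" by simp
    \<comment> \<open>\<open>F k\<close> is the last set already in the union, and it meets the new
      set \<open>F n\<close>.\<close>
    then obtain k where k: "n = Suc k" "m \<le> k" by (cases n) auto
    have "\<Union> (F ` {m..<n}) \<union> F n \<in> \<C>"
    proof (rule connected_Un[OF assms(1) Suc.IH[OF mn] assms(2)])
      show "\<Union> (F ` {m..<n}) \<inter> F n \<noteq> {}"
        using assms(3)[of k] k by fastforce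
    qed
    moreover have "{m..<Suc n} = insert n {m..<n}" using mn by auto
    ultimately show ?thesis by (simp add: Un_commute)
  qed
qed simp

text \<open>Grouping the sets into sufficiently long consecutive blocks makes non-consecutive blocks
  disjoint.\<close>

lemma necklace_of_chain:
  assumes con: "connectoid S \<C>" and F: "\<And>n::nat. F n \<in> \<C>" "\<And>n. finite (F n)"
    and meet: "\<And>n. F n \<inter> F (Suc n) \<noteq> {}"
    and escape: "\<And>n. \<exists>m. \<forall>k\<ge>m. F n \<inter> F k = {}"
  shows "necklace \<C> (\<Union>n. F n)"
proof -
  \<comment> \<open>Finitely many bounds from \<open>escape\<close> combine into one that works for
    all sets of index below \<open>n\<close>.\<close>
  have "\<exists>m>n. \<forall>i<n. \<forall>j\<ge>m. F i \<inter> F j = {}" for n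
  proof (induction n)
    case (Suc n)
    then obtain m where m: "m > n" "\<forall>i<n. \<forall>j\<ge>m. F i \<inter> F j = {}" by blast
    obtain m' where m': "\<forall>k\<ge>m'. F n \<inter> F k = {}" using escape by blast
    show ?case
      using m m' by (intro exI[of _ "Suc (max m m')"]) (auto simp: less_Suc_eq)
  qed auto
  then obtain f where f: "\<And>n. f n > n" "\<And>n i j. i < n \<Longrightarrow> j \<ge> f n \<Longrightarrow> F i \<inter> F j = {}"
    by metis
  \<comment> \<open>Iterating \<open>f\<close> gives block boundaries: sets of index below
    \<open>g k\<close> are disjoint from all sets of index at least
    \<open>g (Suc k)\<close>.\<close>
  define g where "g k = (f ^^ k) 0" for k
  have g0: "g 0 = 0" and gSuc: "\<And>k. g (Suc k) = f (g k)" by (auto simp: g_def)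
  have gmono: "strict_mono g"
    by (simp add: strict_mono_Suc_iff gSuc f(1))
  have sep: "F i \<inter> F j = {}" if "i < g k" "j \<ge> g (Suc k)" for i j k
    using f(2) that gSuc by metis
  \<comment> \<open>Block \<open>k\<close> ends just before \<open>g k\<close>. Blocks count from 1,
    as in a necklace; \<open>H 0\<close> is empty because \<open>0 - 1 = 0\<close> on the
    naturals.\<close>
  define H where "H k = \<Union> (F ` {g (k - 1)..<g k})" for k
  have step: "g (k - 1) < g k" if "k \<ge> 1" for k
    using strict_monoD[OF gmono, of "k - 1" k] that by simp
  have HF: "finite (H k) \<and> H k \<in> \<C>" if "k \<ge> 1" for k
    using connected_chain_Union[where F = F, OF con F(1) meet step[OF that]] F(2)
    unfolding H_def by auto
  have Hne: "H k \<inter> H k \<noteq> {}" if "k \<ge> 1" for k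
    using meet[of "g (k - 1)"] step[OF that] unfolding H_def by fastforce
  have Hnext: "H k \<inter> H (Suc k) \<noteq> {}" if "k \<ge> 1" for k
  proof -
    \<comment> \<open>\<open>p\<close> is the last index of block \<open>k\<close> and
      \<open>Suc p\<close> the first of the next block, so the blocks meet because
      \<open>F p\<close> and \<open>F (Suc p)\<close> do.\<close>
    obtain p where p: "g k = Suc p" "g (k - 1) \<le> p"
      using step[of k] \<open>k \<ge> 1\<close> by (cases "g k") auto
    have "F p \<subseteq> H k" using p unfolding H_def by auto
    moreover have "F (Suc p) \<subseteq> H (Suc k)"
      using p step[of "Suc k"] unfolding H_def by auto
    ultimately show ?thesis using meet[of p] by blast
  qed
  have Hfar: "H k \<inter> H l = {}" if "k \<ge> 1" "k + 2 \<le> l" for k l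
  proof -
    have "g (Suc k) \<le> g (l - 1)"
      using strict_mono_less_eq[OF gmono] that by simp
    then have "F i \<inter> F j = {}" if "i < g k" "j \<ge> g (l - 1)" for i j
      using sep[of i k j] that by simp
    then show ?thesis unfolding H_def by fastforce
  qed
  have Hiff: "H i \<inter> H j \<noteq> {} \<longleftrightarrow> \<bar>int i - int j\<bar> \<le> 1" if "i \<ge> 1" "j \<ge> 1" for i j
  proof -
    consider "i = j" | "j = Suc i" | "i = Suc j" | "i + 2 \<le> j" | "j + 2 \<le> i" by linarith
    then show ?thesis
    proof cases
      case 1
      then show ?thesis using Hne that by simp
    next
      case 2
      then show ?thesis using Hnext[of i] that by simp
    next
      case 3
      then show ?thesis using Hnext[of j] that by (simp add: Int_commute)
    next
      case 4
      then show ?thesis using Hfar[of i j] that by simp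
    next
      case 5
      then show ?thesis using Hfar[of j i] that by (simp add: Int_commute)
    qed
  qed
  have cover: "(\<Union>n. F n) = (\<Union>n\<in>{1..}. H n)"
  proof
    show "(\<Union>n. F n) \<subseteq> (\<Union>n\<in>{1..}. H n)"
    proof
      fix x assume "x \<in> (\<Union>n. F n)"
      then obtain n where n: "x \<in> F n" by blast
      \<comment> \<open>The block containing index \<open>n\<close> is the first one whose right
        boundary exceeds \<open>n\<close>.\<close>
      define k where "k = (LEAST k. n < g k)"
      have "n < g (Suc n)"
        using strict_mono_imp_increasing[OF gmono, of "Suc n"] by simp
      then have k: "n < g k" unfolding k_def by (rule LeastI)
      then have k1: "k \<ge> 1" using g0 by (cases k) auto
      then have "\<not> n < g (k - 1)"
        using not_less_Least[of "k - 1" "\<lambda>k. n < g k"] unfolding k_def by linarith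
      then have "x \<in> H k" using k n unfolding H_def by auto
      then show "x \<in> (\<Union>n\<in>{1..}. H n)" using k1 by auto
    qed
  qed (auto simp: H_def)
  have "(\<Union>n. F n) \<in> \<C>"
  proof (rule connectedI[OF con])
    fix x y assume "x \<in> (\<Union>n. F n)" "y \<in> (\<Union>n. F n)"
    then obtain m n where mn: "x \<in> F m" "y \<in> F n" by blast
    have "\<Union> (F ` {0..<Suc (max m n)}) \<in> \<C>"
      by (rule connected_chain_Union[where F = F, OF con F(1) meet]) simp
    moreover have "m \<in> {0..<Suc (max m n)}" "n \<in> {0..<Suc (max m n)}" by auto
    ultimately show "\<exists>A\<in>\<C>. A \<subseteq> (\<Union>n. F n) \<and> x \<in> A \<and> y \<in> A"
      using mn by (intro bexI[of _ "\<Union> (F ` {0..<Suc (max m n)})"] conjI) blast+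
  qed
  then show ?thesis
    unfolding necklace_def using HF cover Hiff by (intro conjI exI[of _ H]) simp_all
qed


section \<open>Paths in graphs without cycles\<close>

lemma graph_path_iff_successively:
  "graph_path V E p \<longleftrightarrow>
     p \<noteq> [] \<and> set p \<subseteq> V \<and> distinct p \<and> successively (\<lambda>x y. {x, y} \<in> E) p"
  by (auto simp: graph_path_def successively_conv_nth)

lemma graph_path_singleton: "v \<in> V \<Longrightarrow> graph_path V E [v]"
  by (simp add: graph_path_def)

lemma graph_path_rev: "graph_path V E p \<Longrightarrow> graph_path V E (rev p)"
  by (simp add: graph_path_iff_successively successively_rev insert_commute)

lemma graph_path_append1: "graph_path V E (p @ q) \<Longrightarrow> p \<noteq> [] \<Longrightarrow> graph_path V E p"
  by (auto simp: graph_path_iff_successively successively_append_iff)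

lemma graph_path_append2: "graph_path V E (p @ q) \<Longrightarrow> q \<noteq> [] \<Longrightarrow> graph_path V E q"
  by (auto simp: graph_path_iff_successively successively_append_iff)

text \<open>Prepending \<open>u\<close> could repeat a vertex; in that case the part of
  \<open>p\<close> from \<open>u\<close> on already serves.\<close>

lemma graph_path_extend:
  assumes "graph_path V E p" "u \<in> V" "{u, hd p} \<in> E"
  obtains q where "graph_path V E q" "hd q = u" "last q = last p"
proof (cases "u \<in> set p")
  case True
  then obtain a b where p: "p = a @ u # b" by (meson split_list)
  then have "graph_path V E (u # b)" using assms(1) graph_path_append2 by blast
  then show ?thesis using p that[of "u # b"] by simp
next
  case False
  then have "graph_path V E (u # p)"
    using assms by (auto simp: graph_path_iff_successively successively_Cons)
  then show ?thesis
    using assms(1) that[of "u # p"] by (simp add: graph_path_def)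
qed

text \<open>The cycle runs along \<open>p\<close> and back through the interior of
  \<open>q\<close>.\<close>

lemma graph_cycle_of_paths:
  assumes p: "graph_path V E p" and q: "graph_path V E q"
    and ends: "hd p = hd q" "last p = last q"
    and disj: "set p \<inter> set q \<subseteq> {hd p, last p}" and "p \<noteq> q"
  shows "\<exists>c. graph_cycle V E c"
proof -
  have ne: "p \<noteq> []" "q \<noteq> []" using p q by (auto simp: graph_path_def)
  \<comment> \<open>Paths do not repeat vertices, so equal ends would make both paths the same
    single vertex.\<close>
  have uv: "hd p \<noteq> last p"
  proof
    assume eq: "hd p = last p"
    have "w = [hd w]" if "graph_path V E w" "hd w = last w" for w
      using that by (cases w) (auto simp: graph_path_def split: if_splits)
    then have "p = q" using p q eq ends by metis
    with \<open>p \<noteq> q\<close> show False ..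
  qed
  obtain p' where p': "p = hd p # p' @ [last p]"
    using ne(1) uv by (cases p; cases "tl p" rule: rev_cases) auto
  obtain q' where q': "q = hd p # q' @ [last p]"
    using ne(2) uv ends by (cases q; cases "tl q" rule: rev_cases) auto
  define u v where "u = hd p" and "v = last p"
  note p' = p'[folded u_def v_def] and q' = q'[folded u_def v_def]
  define c where "c = u # p' @ v # rev q'"
  have dist: "distinct (u # p' @ [v])" "distinct (u # q' @ [v])"
    using p q p' q' unfolding graph_path_def by metis+
  have "set p' \<inter> set q' = {}"
    using disj p' q' dist uv by (auto simp flip: u_def v_def)
  then have distc: "distinct c" using dist unfolding c_def by auto
  have sp: "successively (\<lambda>x y. {x, y} \<in> E) (u # p' @ [v])"
    using p p' unfolding graph_path_iff_successively by metis
  have sq: "successively (\<lambda>x y. {x, y} \<in> E) (u # q' @ [v])"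
    using q q' unfolding graph_path_iff_successively by metis
  have "successively (\<lambda>x y. {x, y} \<in> E) (rev (q' @ [v]))"
    using sq by (simp add: successively_rev insert_commute successively_Cons del: rev_append)
  then have sc: "successively (\<lambda>x y. {x, y} \<in> E) c"
    using sp unfolding c_def
    by (auto simp: successively_append_iff successively_Cons hd_append)
  have "set (u # p' @ [v]) \<subseteq> V" "set (u # q' @ [v]) \<subseteq> V"
    using p q p' q' unfolding graph_path_def by metis+
  then have "set c \<subseteq> V" unfolding c_def by auto
  then have pc: "graph_path V E c"
    using distc sc unfolding graph_path_iff_successively c_def by simp
  have "{hd (q' @ [v]), u} \<in> E"
    using sq by (auto simp: successively_Cons insert_commute)
  moreover have "last c = hd (q' @ [v])"
    unfolding c_def by (cases q') auto
  ultimately have "{last c, hd c} \<in> E" unfolding c_def by simp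
  \<comment> \<open>Otherwise neither path has an interior, and both would be
    \<open>[u, v]\<close>.\<close>
  moreover have "length c \<ge> 3"
  proof (rule ccontr)
    assume "\<not> length c \<ge> 3"
    then have "p' = [] \<and> q' = []" unfolding c_def by (cases p'; cases q'; simp)
    then show False using p' q' \<open>p \<noteq> q\<close> by simp
  qed
  ultimately show ?thesis using pc unfolding graph_cycle_def by blast
qed

text \<open>Induction on the total length: without a cycle, two different paths share an inner
  vertex \<open>w\<close>, and their parts before and after \<open>w\<close> agree by
  induction.\<close>

lemma graph_path_unique:
  assumes acyclic: "\<nexists>c. graph_cycle V E c"
    and "graph_path V E p" "graph_path V E q" "hd p = hd q" "last p = last q"
  shows "p = q"
  using assms(2-)
proof (induction "length p + length q" arbitrary: p q rule: less_induct)
  case less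
  show ?case
  proof (rule ccontr)
    assume "p \<noteq> q"
    then have "\<not> set p \<inter> set q \<subseteq> {hd p, last p}"
      using acyclic graph_cycle_of_paths less.prems by blast
    then obtain w where w: "w \<in> set p" "w \<in> set q" "w \<noteq> hd p" "w \<noteq> last p" by blast
    obtain p1 p2 where p: "p = p1 @ w # p2" using w(1) by (meson split_list)
    obtain q1 q2 where q: "q = q1 @ w # q2" using w(2) by (meson split_list)
    have ne: "p1 \<noteq> []" "p2 \<noteq> []" "q1 \<noteq> []" "q2 \<noteq> []"
      using w(3,4) less.prems(3,4) p q by auto
    have "p1 @ [w] = q1 @ [w]"
    proof (rule less.hyps)
      show "length (p1 @ [w]) + length (q1 @ [w]) < length p + length q"
        using p q ne by simp
      show "graph_path V E (p1 @ [w])"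
        using graph_path_append1[of V E "p1 @ [w]" p2] less.prems(1) p by simp
      show "graph_path V E (q1 @ [w])"
        using graph_path_append1[of V E "q1 @ [w]" q2] less.prems(2) q by simp
      show "hd (p1 @ [w]) = hd (q1 @ [w])"
        using less.prems(3) p q ne by simp
    qed simp
    moreover have "w # p2 = w # q2"
    proof (rule less.hyps)
      show "length (w # p2) + length (w # q2) < length p + length q"
        using p q ne by simp
      show "graph_path V E (w # p2)"
        using graph_path_append2[of V E p1 "w # p2"] less.prems(1) p by simp
      show "graph_path V E (w # q2)"
        using graph_path_append2[of V E q1 "w # q2"] less.prems(2) q by simp
      show "last (w # p2) = last (w # q2)"
        using less.prems(4) p q ne by simp
    qed simp
    ultimately show False using \<open>p \<noteq> q\<close> p q by simp
  qed
qed


section \<open>From normal spanning trees to well-orders\<close>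

text \<open>This is the lexicographic combination of \<open>h\<close> and \<open>W\<close>;
  well-foundedness is pulled back from the lexicographic product.\<close>

lemma well_order_refine:
  fixes h :: "'a \<Rightarrow> nat"
  assumes W: "well_order_on S W"
  shows "well_order_on S {(s, t) \<in> S \<times> S. h s < h t \<or> h s = h t \<and> (s, t) \<in> W}"
    (is "well_order_on S ?R")
proof -
  have W': "refl_on S W" "trans W" "antisym W" "total_on S W" "wf (W - Id)"
    using W by (auto simp: order_on_defs)
  have "refl_on S ?R" using W'(1) by (auto simp: refl_on_def)
  moreover have "trans ?R"
    using W'(2) unfolding trans_def by auto
  moreover have "antisym ?R" using W'(3) unfolding antisym_def by auto
  moreover have "total_on S ?R"
    using W'(4) unfolding total_on_def by auto
  moreover have "wf (?R - Id)"
  proof (rule wf_subset)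
    show "wf (inv_image (less_than <*lex*> (W - Id)) (\<lambda>s. (h s, s)))"
      using W'(5) by (intro wf_inv_image wf_lex_prod) auto
  qed auto
  ultimately show ?thesis
    by (auto simp: order_on_defs)
qed

lemma countable_separation_of_normal_spanning_tree:
  assumes con: "connectoid S \<C>" and T: "weak_normal_tree S \<C> S E r"
  shows "countable_separation_number S \<C>"
proof -
  have tree: "graph_connected S E" "\<nexists>c. graph_cycle S E c" and r: "r \<in> S"
    and normal: "\<And>C u v. C \<in> \<C> \<Longrightarrow> u \<in> C \<Longrightarrow> v \<in> C \<Longrightarrow> u \<in> S \<Longrightarrow> v \<in> S \<Longrightarrow>
      \<not> tree_le S E r u v \<Longrightarrow> \<not> tree_le S E r v u \<Longrightarrow>
      \<exists>w\<in>C. tree_le S E r w u \<and> tree_le S E r w v"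
  proof -
    show "graph_connected S E" "\<nexists>c. graph_cycle S E c" "r \<in> S"
      using T unfolding weak_normal_tree_def rooted_tree_def undirected_tree_def by simp_all
    have "\<forall>C\<in>\<C>. \<forall>u\<in>C \<inter> S. \<forall>v\<in>C \<inter> S. \<not> tree_le S E r u v \<and> \<not> tree_le S E r v u \<longrightarrow>
        (\<exists>w\<in>C. tree_le S E r w u \<and> tree_le S E r w v)"
      using T unfolding weak_normal_tree_def by simp
    then show "\<exists>w\<in>C. tree_le S E r w u \<and> tree_le S E r w v"
      if "C \<in> \<C>" "u \<in> C" "v \<in> C" "u \<in> S" "v \<in> S"
        "\<not> tree_le S E r u v" "\<not> tree_le S E r v u" for C u v
      using that by simp
  qed
  have "\<forall>v\<in>S. \<exists>p. graph_path S E p \<and> hd p = r \<and> last p = v"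
    using tree(1) r unfolding graph_connected_def by blast
  then obtain P where P: "\<And>v. v \<in> S \<Longrightarrow> graph_path S E (P v) \<and> hd (P v) = r \<and> last (P v) = v"
    by metis
  have P_unique: "p = P v" if "graph_path S E p" "hd p = r" "last p = v" "v \<in> S" for p v
    using graph_path_unique[OF tree(2)] that P by metis
  have le_iff: "tree_le S E r u v \<longleftrightarrow> u \<in> set (P v)" if "v \<in> S" for u v
    unfolding tree_le_def by (metis P P_unique that)
  define h where "h v = length (P v)" for v
  have h_less: "h u < h v" if uv: "u \<in> set (P v)" "u \<noteq> v" and v: "v \<in> S" for u v
  proof -
    \<comment> \<open>The part of \<open>P v\<close> up to \<open>u\<close> is a path from the root,
      hence equals \<open>P u\<close>, and it is a proper initial segment.\<close>
    obtain a b where ab: "P v = a @ u # b" using uv(1) by (meson split_list)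
    have "b \<noteq> []" using ab P[OF v] uv(2) by auto
    have path: "graph_path S E (a @ [u])"
      using graph_path_append1[of S E "a @ [u]" b] ab P[OF v] by simp
    have "hd (a @ [u]) = r" using ab P[OF v] by (cases a) auto
    moreover have "u \<in> S" using path by (simp add: graph_path_def)
    ultimately have "P u = a @ [u]" using P_unique path by (metis last_snoc)
    then show ?thesis using ab \<open>b \<noteq> []\<close> unfolding h_def by simp
  qed
  obtain W where "well_order_on S W" using well_order_on by blast
  define R where "R = {(s, t) \<in> S \<times> S. h s < h t \<or> h s = h t \<and> (s, t) \<in> W}"
  have R: "well_order_on S R" unfolding R_def by (rule well_order_refine) fact
  have "\<exists>X. finite X \<and> X \<subseteq> underS R s \<and>
      (\<exists>K\<in>connectoid_components \<C> (S - X). s \<in> K \<and> K \<inter> underS R s = {})" if s: "s \<in> S" for s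
  proof -
    define X where "X = set (P s) - {s}"
    have "set (P s) \<subseteq> S" using P[OF s] by (simp add: graph_path_def)
    then have "X \<subseteq> underS R s"
      using h_less s unfolding X_def by (auto simp: underS_def R_def)
    obtain K where K: "K \<in> connectoid_components \<C> (S - X)" "s \<in> K"
      by (rule component_exists[OF con, of s "S - X"]) (use s in \<open>auto simp: X_def\<close>)
    have KC: "K \<in> \<C>" "K \<subseteq> S - X"
      using K(1) unfolding connectoid_components_def by simp_all
    have "t \<notin> underS R s" if t: "t \<in> K" for t
    proof
      assume tR: "t \<in> underS R s"
      then have ts: "t \<noteq> s" "t \<in> S" "h t \<le> h s"
        by (auto simp: underS_def R_def)
      \<comment> \<open>An earlier \<open>t\<close> in \<open>K\<close> is not below
        \<open>s\<close>, since \<open>X\<close> was removed, and not above \<open>s\<close>, since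
        it is not higher. Normality then puts a common lower bound into \<open>K\<close>, which
        would have to lie in \<open>X\<close>.\<close>
      have "\<not> tree_le S E r t s"
        using KC(2) t ts le_iff[OF s] unfolding X_def by blast
      moreover have "\<not> tree_le S E r s t"
        using le_iff[OF ts(2)] h_less[of s t] ts by auto
      ultimately obtain w where w: "w \<in> K" "tree_le S E r w s" "tree_le S E r w t"
        using normal[OF KC(1) t K(2)] s ts by blast
      then have "w \<noteq> s" using \<open>\<not> tree_le S E r s t\<close> by blast
      then have "w \<in> X" using w(2) le_iff[OF s] unfolding X_def by blast
      then show False using w(1) KC(2) by blast
    qed
    then have "K \<inter> underS R s = {}" by blast
    moreover have "finite X" unfolding X_def by simp
    ultimately show ?thesis using \<open>X \<subseteq> underS R s\<close> K by blast
  qed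
  then show ?thesis using R unfolding countable_separation_number_def by blast
qed


section \<open>Trees given by a parent function\<close>

text \<open>The height \<open>h\<close> only has to drop along \<open>parent\<close>, so that
  climbing ends at \<open>r\<close>. The last two assumptions determine \<open>le\<close> on
  \<open>V\<close> by recursion along \<open>parent\<close>: it is the ancestor relation.\<close>

locale parent_tree =
  fixes V :: "'a set" and r :: 'a and parent :: "'a \<Rightarrow> 'a" and h :: "'a \<Rightarrow> nat"
    and le :: "'a \<Rightarrow> 'a \<Rightarrow> bool"
  assumes root: "r \<in> V"
    and parent: "v \<in> V \<Longrightarrow> v \<noteq> r \<Longrightarrow> parent v \<in> V \<and> h (parent v) < h v"
    and le_root: "u \<in> V \<Longrightarrow> le u r \<longleftrightarrow> u = r"
    and le_parent: "u \<in> V \<Longrightarrow> v \<in> V \<Longrightarrow> v \<noteq> r \<Longrightarrow> le u v \<longleftrightarrow> u = v \<or> le u (parent v)"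
begin

definition edges :: "'a set set" where
  "edges = (\<lambda>v. {v, parent v}) ` (V - {r})"

lemma edge_cases:
  assumes "{u, v} \<in> edges"
  obtains "v \<in> V - {r}" "u = parent v" | "u \<in> V - {r}" "v = parent u"
  using assms unfolding edges_def doubleton_eq_iff image_iff by metis

lemma reach_root:
  assumes "v \<in> V"
  shows "\<exists>p. graph_path V edges p \<and> hd p = v \<and> last p = r"
  using assms
proof (induction "h v" arbitrary: v rule: less_induct)
  case less
  show ?case
  proof (cases "v = r")
    case True
    then show ?thesis using graph_path_singleton[OF root] by (intro exI[of _ "[r]"]) simp
  next
    case False
    then obtain p where "graph_path V edges p" "hd p = parent v" "last p = r"
      using less parent by blast
    moreover have "{v, parent v} \<in> edges" using less.prems False unfolding edges_def by blast
    ultimately show ?thesis using graph_path_extend[of V edges p v] less.prems by metis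
  qed
qed

text \<open>Induction on the height of \<open>u\<close>: climb to the parent; at the root, reverse
  the path from \<open>v\<close> to \<open>r\<close>.\<close>

lemma connected: "graph_connected V edges"
proof -
  have "\<exists>p. graph_path V edges p \<and> hd p = u \<and> last p = v" if "u \<in> V" "v \<in> V" for u v
    using that
  proof (induction "h u" arbitrary: u rule: less_induct)
    case less
    show ?case
    proof (cases "u = r")
      case True
      obtain p where p: "graph_path V edges p" "hd p = v" "last p = r"
        using reach_root less.prems(2) by blast
      then have "p \<noteq> []" by (simp add: graph_path_def)
      then show ?thesis
        using p True graph_path_rev[OF p(1)] by (intro exI[of _ "rev p"]) (simp add: hd_rev last_rev)
    next
      case False
      then obtain p where "graph_path V edges p" "hd p = parent u" "last p = v"
        using less parent by blast
      moreover have "{u, parent u} \<in> edges" using less.prems False unfolding edges_def by blast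
      ultimately show ?thesis using graph_path_extend[of V edges p u] less.prems by metis
    qed
  qed
  then show ?thesis using root unfolding graph_connected_def by blast
qed

text \<open>Both neighbours of a vertex of maximal height on a cycle would have to be its parent.\<close>

lemma acyclic: "\<not> graph_cycle V edges c"
proof
  assume c: "graph_cycle V edges c"
  define n where "n = length c"
  have n: "n \<ge> 3" and "c \<noteq> []" and dist: "distinct c"
    and E: "\<And>i. Suc i < n \<Longrightarrow> {c ! i, c ! Suc i} \<in> edges" and El: "{c ! (n - 1), c ! 0} \<in> edges"
    using c by (auto simp: graph_cycle_def graph_path_def n_def last_conv_nth hd_conv_nth)
  have "Max (h ` set c) \<in> h ` set c" using \<open>c \<noteq> []\<close> by (intro Max_in) auto
  then obtain i where i: "i < n" "h (c ! i) = Max (h ` set c)"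
    unfolding n_def by (metis (no_types, lifting) imageE in_set_conv_nth)
  \<comment> \<open>A neighbour having \<open>c ! i\<close> as its parent would be higher than the
    maximum.\<close>
  have up: "c ! j = parent (c ! i)" if "j < n" "{c ! i, c ! j} \<in> edges" for j
  proof -
    have "h (c ! j) \<le> h (c ! i)"
      using that(1) i(2) unfolding n_def by simp
    from that(2) show ?thesis
    proof (cases rule: edge_cases)
      case 1
      then have "h (c ! i) < h (c ! j)" using parent by auto
      with \<open>h (c ! j) \<le> h (c ! i)\<close> show ?thesis by simp
    qed simp
  qed
  \<comment> \<open>\<open>a\<close> and \<open>b\<close> are the cyclic neighbours of index
    \<open>i\<close>; they differ because the cycle has at least three vertices.\<close>
  define a where "a = (if i = 0 then n - 1 else i - 1)"
  define b where "b = (if i = n - 1 then 0 else Suc i)"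
  have ab: "a < n" "b < n" "a \<noteq> b" using i(1) n unfolding a_def b_def by auto
  have "{c ! i, c ! a} \<in> edges"
    using El E[of "i - 1"] i(1) unfolding a_def by (auto simp: insert_commute)
  moreover have "{c ! i, c ! b} \<in> edges"
    using El E[of i] i(1) unfolding b_def by auto
  ultimately have "c ! a = c ! b" using up ab by metis
  then show False using dist ab unfolding n_def by (simp add: nth_eq_iff_index_eq)
qed

lemma rooted_tree: "rooted_tree V edges r"
proof -
  have "v \<noteq> parent v" if "v \<in> V - {r}" for v using parent[of v] that by fastforce
  then have "simple_graph V edges"
    using parent unfolding simple_graph_def edges_def by (auto simp: card_2_iff)
  then show ?thesis
    using connected acyclic root unfolding rooted_tree_def undirected_tree_def by blast
qed

text \<open>Leaving the root, the first edge must lead to a child; a later edge to the parent would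
  revisit the preceding vertex, against injectivity. An index function covers both finite paths and
  rays.\<close>

lemma parent_of_consecutive:
  assumes "R 0 = r" "\<And>i. i \<le> n \<Longrightarrow> {R i, R (Suc i)} \<in> edges" "inj_on R {..Suc n}"
  shows "R (Suc n) \<in> V - {r} \<and> R n = parent (R (Suc n))"
  using assms(2,3)
proof (induction n)
  case 0
  have "{R 0, R 1} \<in> edges" using 0 by simp
  then show ?case using assms(1) by (elim edge_cases) auto
next
  case (Suc n)
  have IH: "R n = parent (R (Suc n))"
    using Suc.IH Suc.prems inj_on_subset[of R "{..Suc (Suc n)}" "{..Suc n}"] by simp
  have "R (Suc (Suc n)) \<noteq> R n"
    using Suc.prems(2) unfolding inj_on_def by fastforce
  moreover have "{R (Suc n), R (Suc (Suc n))} \<in> edges" using Suc.prems(1) by simp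
  ultimately show ?case using IH by (elim edge_cases) auto
qed

text \<open>On a path from the root each vertex is the parent of the next, so
  \<open>le_parent\<close> adds exactly one predecessor per step, and the path consists of the
  \<open>le\<close>-predecessors of its end.\<close>

lemma tree_le_iff: "tree_le V edges r u v \<longleftrightarrow> u \<in> V \<and> v \<in> V \<and> le u v"
proof -
  have anc: "{u \<in> V. le u (p ! i)} = set (take (Suc i) p)"
    if p: "graph_path V edges p" "hd p = r" and "i < length p" for p i
    using that(3)
  proof (induction i)
    case 0
    then have "p ! 0 = r" using p(2) by (simp add: hd_conv_nth)
    moreover have "take (Suc 0) p = [p ! 0]" using 0 by (cases p) auto
    ultimately show ?case using le_root root by auto
  next
    case (Suc i)
    have "p \<noteq> []" using p(1) by (simp add: graph_path_def)
    have "p ! Suc i \<in> V - {r} \<and> p ! i = parent (p ! Suc i)"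
    proof (rule parent_of_consecutive)
      show "p ! 0 = r" using p(2) \<open>p \<noteq> []\<close> by (simp add: hd_conv_nth)
      show "{p ! j, p ! Suc j} \<in> edges" if "j \<le> i" for j
        using p(1) that Suc.prems by (simp add: graph_path_def)
      show "inj_on ((!) p) {..Suc i}"
        using p(1) Suc.prems by (auto simp: graph_path_def intro!: inj_on_nth)
    qed
    then have "{u \<in> V. le u (p ! Suc i)} = insert (p ! Suc i) {u \<in> V. le u (p ! i)}"
      using le_parent by auto
    then show ?case
      using Suc.IH Suc.prems by (auto simp: take_Suc_conv_app_nth)
  qed
  have set_p: "set p = {u \<in> V. le u v}" "v \<in> V"
    if p: "graph_path V edges p" "hd p = r" "last p = v" for p
  proof -
    have ne: "p \<noteq> []" using p(1) by (simp add: graph_path_def)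
    then show "set p = {u \<in> V. le u v}"
      using anc[OF p(1,2), of "length p - 1"] p(3) by (simp add: last_conv_nth)
    show "v \<in> V" using ne p(1,3) by (auto simp: graph_path_def)
  qed
  show ?thesis
  proof
    assume "tree_le V edges r u v"
    then show "u \<in> V \<and> v \<in> V \<and> le u v" using set_p unfolding tree_le_def by blast
  next
    assume uv: "u \<in> V \<and> v \<in> V \<and> le u v"
    then obtain p where "graph_path V edges p" "hd p = r" "last p = v"
      using connected root unfolding graph_connected_def by blast
    then show "tree_le V edges r u v" using set_p uv unfolding tree_le_def by blast
  qed
qed

lemma ray_parent:
  assumes "graph_ray V edges R" "R 0 = r"
  shows "R (Suc n) \<in> V - {r} \<and> R n = parent (R (Suc n))"
proof (rule parent_of_consecutive)
  show "inj_on R {..Suc n}"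
    using assms(1) inj_on_subset unfolding graph_ray_def by blast
qed (use assms in \<open>auto simp: graph_ray_def\<close>)

end


section \<open>From well-orders to normal spanning trees\<close>

text \<open>\<open>X\<close> and \<open>K\<close> are choice functions for the separators and
  components provided by a witnessing well-order.\<close>

locale separated_connectoid =
  fixes S :: "'a set" and \<C> :: "'a set set" and R :: "'a rel"
    and X K :: "'a \<Rightarrow> 'a set"
  assumes con: "connectoid S \<C>" and S: "S \<in> \<C>" "S \<noteq> {}" and R: "well_order_on S R"
    and X: "s \<in> S \<Longrightarrow> finite (X s) \<and> X s \<subseteq> underS R s"
    and K: "s \<in> S \<Longrightarrow> K s \<in> connectoid_components \<C> (S - X s)"
    and K_self: "s \<in> S \<Longrightarrow> s \<in> K s"
    and K_underS: "s \<in> S \<Longrightarrow> K s \<inter> underS R s = {}"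
begin

lemma R_wf: "wf (R - Id)"
  and R_subset: "R \<subseteq> S \<times> S"
  using R by (auto simp: order_on_defs)

lemma R_trans: "(s, t) \<in> R \<Longrightarrow> (t, u) \<in> R \<Longrightarrow> (s, u) \<in> R"
  using R by (auto simp: order_on_defs dest: transD)

lemma R_antisym: "(s, t) \<in> R \<Longrightarrow> (t, s) \<in> R \<Longrightarrow> s = t"
  using R by (auto simp: order_on_defs dest: antisymD)

lemma R_total: "s \<in> S \<Longrightarrow> t \<in> S \<Longrightarrow> (s, t) \<in> R \<or> (t, s) \<in> R"
  using R by (cases "s = t") (auto simp: order_on_defs total_on_def dest: refl_onD)

section \<open>The laminar family of the sets \<open>K s\<close>\<close>

lemma K_connected: "s \<in> S \<Longrightarrow> K s \<in> \<C>"
  using K by (auto simp: connectoid_components_def)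

lemma K_subset: "s \<in> S \<Longrightarrow> K s \<subseteq> S"
  using K_connected connected_subset[OF con] by blast

lemma K_above: "s \<in> S \<Longrightarrow> t \<in> K s \<Longrightarrow> (s, t) \<in> R"
  using K_underS[of s] K_subset[of s] R_total[of s t] R_total[of s s] unfolding underS_def by blast

lemma subset_K:
  assumes "s \<in> S" "A \<in> \<C>" "s \<in> A" "A \<inter> X s = {}"
  shows "A \<subseteq> K s"
  using component_greatest[OF con K[OF assms(1)] assms(2)] connected_subset[OF con assms(2)]
    K_self[OF assms(1)] assms(3,4) by blast

text \<open>The separator lies strictly below \<open>s\<close>, so a set with least element
  \<open>s\<close> misses it. With \<open>K_above\<close> this describes \<open>K s\<close> by the
  order alone, without \<open>X s\<close>.\<close>

lemma subset_K_least:
  assumes "A \<in> \<C>" "s \<in> A" "\<And>t. t \<in> A \<Longrightarrow> (s, t) \<in> R"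
  shows "A \<subseteq> K s"
proof (rule subset_K)
  show "s \<in> S" using assms(1,2) connected_subset[OF con] by blast
  then show "A \<inter> X s = {}"
    using X[of s] assms(3) R_antisym unfolding underS_def by blast
qed fact+

lemma least_exists:
  assumes "A \<subseteq> S" "A \<noteq> {}"
  obtains m where "m \<in> A" "\<And>t. t \<in> A \<Longrightarrow> (m, t) \<in> R"
proof -
  obtain m where m: "m \<in> A" "\<And>y. (y, m) \<in> R - Id \<Longrightarrow> y \<notin> A"
    using wfE_min'[OF R_wf assms(2)] by blast
  have "(m, t) \<in> R" if "t \<in> A" for t
    using m(1) m(2)[of t] that assms(1) R_total[of m t] R_total[of m m] by auto
  then show ?thesis using m(1) that by blast
qed

text \<open>Take \<open>m\<close> least in \<open>A\<close>. For \<open>A = S\<close> this gives the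
  root, for other connected sets the common lower bound in weak normality.\<close>

lemma connected_subset_K:
  assumes "A \<in> \<C>" "A \<noteq> {}"
  obtains m where "m \<in> A" "A \<subseteq> K m"
  using least_exists[OF connected_subset[OF con assms(1)] assms(2)] subset_K_least[OF assms(1)]
  by metis

text \<open>The union is connected with least element \<open>s\<close>. This is transitivity of the
  order \<open>t \<in> K s\<close>.\<close>

lemma K_mono:
  assumes "s \<in> S" "t \<in> K s"
  shows "K t \<subseteq> K s"
proof -
  have t: "t \<in> S" using assms K_subset by blast
  have "K s \<union> K t \<in> \<C>"
    using connected_Un[OF con] K_connected K_self assms t by blast
  moreover have "(s, x) \<in> R" if "x \<in> K s \<union> K t" for x
    using that K_above[OF assms(1)] K_above[OF t] assms(2) R_trans by blast
  ultimately show ?thesis using subset_K_least[of "K s \<union> K t" s] K_self[OF assms(1)] by blast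
qed

text \<open>Again the union has least element \<open>s\<close>. Together with \<open>K_mono\<close>,
  sets \<open>K s\<close> and \<open>K u\<close> that meet are nested.\<close>

lemma K_laminar:
  assumes "s \<in> S" "u \<in> S" "(s, u) \<in> R" "K s \<inter> K u \<noteq> {}"
  shows "u \<in> K s"
proof -
  have "K s \<union> K u \<in> \<C>"
    using connected_Un[OF con] K_connected assms by blast
  moreover have "(s, x) \<in> R" if "x \<in> K s \<union> K u" for x
    using that K_above[OF assms(1)] K_above[OF assms(2)] assms(3) R_trans by blast
  ultimately show ?thesis
    using subset_K_least[of "K s \<union> K u" s] K_self assms by blast
qed

section \<open>Predecessors and parents in the tree order\<close>

definition preds :: "'a \<Rightarrow> 'a set" where
  "preds t = {s \<in> S. t \<in> K s}"

lemma preds_self: "t \<in> S \<Longrightarrow> t \<in> preds t"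
  using K_self by (simp add: preds_def)

text \<open>If \<open>t \<in> K s\<close> and \<open>s \<noteq> t\<close>, then the connected set \<open>K s\<close> contains \<open>s \<notin> K t\<close>, so it meets
  the finite separator \<open>X t\<close>; hence \<open>s\<close> is a predecessor of one of the finitely many
  \<open>y \<in> X t\<close>, all of which are smaller than \<open>t\<close>.\<close>

lemma finite_preds: "t \<in> S \<Longrightarrow> finite (preds t)"
proof (induction t rule: wf_induct_rule[OF R_wf])
  case (1 t)
  have "preds t \<subseteq> insert t (\<Union>y\<in>X t. preds y)"
  proof
    fix s assume s: "s \<in> preds t"
    show "s \<in> insert t (\<Union>y\<in>X t. preds y)"
    proof (cases "s = t")
      case False
      have st: "s \<in> S" "t \<in> K s" using s by (auto simp: preds_def)
      then have "s \<in> underS R t" using K_above False by (simp add: underS_def)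
      then have "\<not> K s \<subseteq> K t" using K_underS[OF 1(2)] K_self[OF st(1)] by blast
      then have "K s \<inter> X t \<noteq> {}"
        using subset_K[OF 1(2) K_connected[OF st(1)] st(2)] by blast
      then show ?thesis using st by (auto simp: preds_def)
    qed simp
  qed
  moreover have "finite (preds y)" if "y \<in> X t" for y
    using that 1 X[OF 1(2)] R_subset unfolding underS_def by blast
  ultimately show ?case
    using X[OF 1(2)] by (meson finite_UN_I finite_insert finite_subset)
qed

lemma preds_mono: "s \<in> preds t \<Longrightarrow> preds s \<subseteq> preds t"
  using K_mono unfolding preds_def by blast

text \<open>This allows the number of predecessors to serve as the height in the tree.\<close>

lemma card_preds_less:
  assumes "s \<in> preds t" "s \<noteq> t" "t \<in> S"
  shows "card (preds s) < card (preds t)"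
proof (rule psubset_card_mono)
  have "t \<notin> preds s"
    using assms K_above[of s t] K_above[of t s] R_antisym unfolding preds_def by blast
  then show "preds s \<subset> preds t"
    using preds_mono assms preds_self by blast
qed (rule finite_preds[OF assms(3)])

text \<open>The parent is the strict predecessor \<open>u\<close> of \<open>t\<close> with the most
  predecessors.\<close>

lemma parent_exists:
  assumes t: "t \<in> S" and "preds t \<noteq> {t}"
  shows "\<exists>u\<in>S. u \<in> preds t \<and> u \<noteq> t \<and> preds t = insert t (preds u)"
proof -
  define A where "A = preds t - {t}"
  have A: "finite A" "A \<noteq> {}"
    using finite_preds preds_self assms unfolding A_def by auto
  then have "Max ((card \<circ> preds) ` A) \<in> (card \<circ> preds) ` A" by (intro Max_in) auto
  then obtain u where u: "u \<in> A" "card (preds u) = Max ((card \<circ> preds) ` A)" by auto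
  have u': "u \<in> S" "u \<in> preds t" "u \<noteq> t" using u(1) by (auto simp: A_def preds_def)
  have "s \<in> preds u" if s: "s \<in> A" for s
  proof -
    have s': "s \<in> S" "s \<in> preds t" using s by (auto simp: A_def preds_def)
    \<comment> \<open>\<open>K s\<close> and \<open>K u\<close> share \<open>t\<close>, so
      \<open>s\<close> and \<open>u\<close> are comparable by laminarity; \<open>u\<close> strictly
      below \<open>s\<close> would contradict the maximality of \<open>u\<close>.\<close>
    have "card (preds s) \<le> card (preds u)" using u(2) A(1) s by simp
    then have "u \<notin> preds s \<or> u = s" using card_preds_less s'(1) by fastforce
    moreover have meet: "K s \<inter> K u \<noteq> {}" using s'(2) u'(2) by (auto simp: preds_def)
    moreover have "(s, u) \<in> R \<or> (u, s) \<in> R"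
      using R_total s'(1) u'(1) by blast
    ultimately show ?thesis
      using K_laminar[of s u] K_laminar[of u s] s'(1) u'(1) preds_self
      by (auto simp: preds_def Int_commute)
  qed
  then have "preds t = insert t (preds u)"
    using preds_mono[OF u'(2)] preds_self[OF t] unfolding A_def by blast
  then show ?thesis using u' by blast
qed

section \<open>The normal spanning tree and necklaces along its rays\<close>

lemma normal_spanning_tree: "has_normal_spanning_tree S \<C>"
proof -
  obtain r where r: "r \<in> S" "S \<subseteq> K r"
    by (rule connected_subset_K[OF S])
  have r_preds: "r \<in> preds t" if "t \<in> S" for t
    using r that by (auto simp: preds_def)
  have "\<forall>t\<in>S - {r}. \<exists>u. u \<in> S \<and> u \<in> preds t \<and> u \<noteq> t \<and> preds t = insert t (preds u)"
  proof
    fix t assume t: "t \<in> S - {r}"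
    then have "preds t \<noteq> {t}" using r_preds[of t] by auto
    then show "\<exists>u. u \<in> S \<and> u \<in> preds t \<and> u \<noteq> t \<and> preds t = insert t (preds u)"
      using parent_exists[of t] t by auto
  qed
  from bchoice[OF this] obtain parent where parent: "\<And>t. t \<in> S - {r} \<Longrightarrow> parent t \<in> S \<and>
      parent t \<in> preds t \<and> parent t \<noteq> t \<and> preds t = insert t (preds (parent t))"
    by auto
  interpret T: parent_tree S r parent "\<lambda>t. card (preds t)" "\<lambda>s t. t \<in> K s"
  proof
    show "r \<in> S" by fact
    show "parent v \<in> S \<and> card (preds (parent v)) < card (preds v)" if "v \<in> S" "v \<noteq> r" for v
      using parent[of v] card_preds_less that by blast
    show "r \<in> K u \<longleftrightarrow> u = r" if "u \<in> S" for u
    proof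
      assume "r \<in> K u"
      then have "(u, r) \<in> R" "(r, u) \<in> R" using K_above r that by auto
      then show "u = r" by (rule R_antisym)
    qed (use K_self r in auto)
    show "v \<in> K u \<longleftrightarrow> u = v \<or> parent v \<in> K u" if "u \<in> S" "v \<in> S" "v \<noteq> r" for u v
      using parent[of v] that unfolding preds_def by blast
  qed
  have "weak_normal_tree S \<C> S T.edges r"
    unfolding weak_normal_tree_def
  proof (intro conjI ballI impI)
    show "rooted_tree S T.edges r" by (rule T.rooted_tree)
  next
    fix C u v
    assume C: "C \<in> \<C>" and uv: "u \<in> C \<inter> S" "v \<in> C \<inter> S"
    \<comment> \<open>Both \<open>u\<close> and \<open>v\<close> lie in \<open>K m\<close>, so
      \<open>m\<close> is below both.\<close>
    obtain m where "m \<in> C" "C \<subseteq> K m"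
      by (rule connected_subset_K[OF C]) (use uv in auto)
    then show "\<exists>w\<in>C. tree_le S T.edges r w u \<and> tree_le S T.edges r w v"
      using uv connected_subset[OF con C] unfolding T.tree_le_iff by (intro bexI[of _ m]) auto
  next
    fix u v
    assume uv: "u \<in> S" "v \<in> S" "tree_le S T.edges r u v"
    \<comment> \<open>\<open>K u\<close> serves as the connected set: its elements are not before
      \<open>u\<close> in \<open>R\<close>, whereas a strict tree predecessor of \<open>u\<close>
      is.\<close>
    have "\<not> tree_less S T.edges r w u" if "w \<in> K u" for w
      using that K_above[of w u] K_above[of u w] uv R_antisym[of u w]
      unfolding tree_less_def T.tree_le_iff by auto
    then show "\<exists>C\<in>\<C>. u \<in> C \<and> v \<in> C \<and> \<not> (\<exists>w\<in>C. tree_less S T.edges r w u)"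
      using uv K_connected[of u] K_self[of u] unfolding T.tree_le_iff by (intro bexI[of _ "K u"]) auto
  qed simp
  moreover have "\<exists>N. necklace \<C> N \<and> finite (range Q - N)"
    if Q: "graph_ray S T.edges Q" "Q 0 = r" for Q
  proof -
    have QS: "Q n \<in> S" for n using Q(1) by (auto simp: graph_ray_def)
    have Qinj: "inj Q" using Q(1) by (simp add: graph_ray_def)
    have Qstep: "Q (Suc n) \<in> K (Q n)" for n
      using parent[of "Q (Suc n)"] T.ray_parent[OF Q, of n] by (auto simp: preds_def)
    have Kdec: "K (Q m) \<subseteq> K (Q n)" if "n \<le> m" for m n
      using that by (induction rule: dec_induct) (use K_mono[OF QS Qstep] in blast)+
    have "\<exists>F. F \<in> \<C> \<and> finite F \<and> F \<subseteq> K (Q n) \<and> Q n \<in> F \<and> Q (Suc n) \<in> F" for n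
      using finite_connected_joining[OF con K_connected[OF QS] K_self[OF QS] Qstep] by metis
    then obtain F where F: "\<And>n. F n \<in> \<C>" "\<And>n. finite (F n)" "\<And>n. F n \<subseteq> K (Q n)"
      "\<And>n. Q n \<in> F n" "\<And>n. Q (Suc n) \<in> F n"
      by metis
    \<comment> \<open>A point in every \<open>K (Q k)\<close> would have infinitely many
      predecessors; as these sets decrease, a point outside one is outside all later ones.\<close>
    have leave: "\<exists>m. \<forall>k\<ge>m. x \<notin> K (Q k)" for x
    proof (rule ccontr)
      assume "\<nexists>m. \<forall>k\<ge>m. x \<notin> K (Q k)"
      then have all: "x \<in> K (Q k)" for k using Kdec by blast
      then have "range Q \<subseteq> preds x" using QS by (auto simp: preds_def)
      moreover have "x \<in> S" using all[of 0] K_subset QS by blast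
      ultimately have "finite (range Q)" using finite_preds finite_subset by blast
      then show False using Qinj by (simp add: finite_image_iff)
    qed
    have escape: "\<exists>m. \<forall>k\<ge>m. F n \<inter> F k = {}" for n
    proof -
      \<comment> \<open>\<open>F n\<close> is finite, so the maximum of \<open>l\<close> over it
        bounds the time when all its points have left.\<close>
      obtain l where l: "\<And>x k. l x \<le> k \<Longrightarrow> x \<notin> K (Q k)" using leave by metis
      have "F n \<inter> F k = {}" if "k \<ge> Max (l ` F n)" for k
      proof (rule ccontr)
        assume "F n \<inter> F k \<noteq> {}"
        then obtain x where x: "x \<in> F n" "x \<in> F k" by blast
        then have "l x \<le> k" using that F(2) by (meson Max_ge finite_imageI image_eqI le_trans)
        then show False using l x(2) F(3) by blast
      qed
      then show ?thesis by blast
    qed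
    \<comment> \<open>Consecutive sets share \<open>Q (Suc n)\<close>.\<close>
    have "necklace \<C> (\<Union>n. F n)"
      by (rule necklace_of_chain[OF con F(1,2) _ escape]) (use F(4,5) in blast)
    moreover have "range Q - (\<Union>n. F n) = {}" using F(4) by blast
    ultimately show ?thesis by (metis finite.emptyI)
  qed
  ultimately show ?thesis
    unfolding has_normal_spanning_tree_def normal_tree_def by blast
qed

end

text \<open>For empty \<open>S\<close> the equivalence fails: a rooted tree has a vertex, while the
  empty well-order satisfies the separation condition vacuously.\<close>

theorem theorem1p4:
  fixes S :: "'a set" and \<C> :: "'a set set"
  assumes "connected_connectoid S \<C>" and "S \<noteq> {}"
  shows "has_normal_spanning_tree S \<C> \<longleftrightarrow> countable_separation_number S \<C>"
proof
  assume "has_normal_spanning_tree S \<C>"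
  then obtain E r where "weak_normal_tree S \<C> S E r"
    unfolding has_normal_spanning_tree_def normal_tree_def by metis
  then show "countable_separation_number S \<C>"
    using countable_separation_of_normal_spanning_tree assms(1)
    unfolding connected_connectoid_def by metis
next
  assume "countable_separation_number S \<C>"
  then obtain R where R: "well_order_on S R"
    and sep: "\<forall>s\<in>S. \<exists>X. finite X \<and> X \<subseteq> underS R s \<and>
      (\<exists>K\<in>connectoid_components \<C> (S - X). s \<in> K \<and> K \<inter> underS R s = {})"
    unfolding countable_separation_number_def by metis
  from bchoice[OF sep] obtain X where X: "\<forall>s\<in>S. finite (X s) \<and> X s \<subseteq> underS R s \<and>
      (\<exists>K\<in>connectoid_components \<C> (S - X s). s \<in> K \<and> K \<inter> underS R s = {})" ..
  then have "\<forall>s\<in>S. \<exists>K. K \<in> connectoid_components \<C> (S - X s) \<and> s \<in> K \<and> K \<inter> underS R s = {}"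
    by auto
  from bchoice[OF this] obtain K where "\<forall>s\<in>S. K s \<in> connectoid_components \<C> (S - X s) \<and>
      s \<in> K s \<and> K s \<inter> underS R s = {}" ..
  with X interpret separated_connectoid S \<C> R X K
    using assms R by unfold_locales (auto simp: connected_connectoid_def)
  show "has_normal_spanning_tree S \<C>" by (rule normal_spanning_tree)
qed

end
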